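(* Let $(X,d,p,\sigma)$ be a power distance space with $(p,\sigma)\in(\mathbb{R}^*\setminus\{0\})\times\mathbb{R}^+$. If $2\sigma\le 2^{1/p}$, then every open ball $B(x,r)$ in $(X,d)$ is open in $(X,d)$.
   Context: A distance on a set $X$ is a function $d:X\times X\to\mathbb{R}$ such that for all $x,y\in X$: $d(x,y)\ge 0$; $d(x,y)=0\iff x=y$; $d(x,y)=d(y,x)$. The pair $(X,d)$ is then a distance space. For $x\in X$ and real $r>0$, the open ball is $B(x,r)=\{y\in X\mid d(x,y)<r\}$. A set $U\subseteq X$ is open in $(X,d)$ if for every $x\in U$ there is a real $r>0$ with $B(x,r)\subseteq U$. $\mathbb{R}^*=\mathbb{R}\cup\{-\infty,\infty\}$, $\mathbb{R}^+$ is the set of positive reals, and $2^{1/p}=1$ for $p=\pm\infty$. The power triangle function is $\tau(p,\sigma;x,y,z;d)=2\sigma\left[\tfrac12 d^p(x,z)+\tfrac12 d^p(z,y)\right]^{1/p}$, where for $p=\infty,0,-\infty$ it is interpreted by its limit in $p$, namely $2\sigma\max\{d(x,z),d(z,y)\}$, $2\sigma\sqrt{d(x,z)}\sqrt{d(z,y)}$, $2\sigma\min\{d(x,z),d(z,y)\}$ respectively, and for $p<0$ with $d(x,z)=0$ or $d(z,y)=0$ it is read as its limiting value $0$. The tuple $(X,d,p,\sigma)$, with $(p,\sigma)\in\mathbb{R}^*\times\mathbb{R}^+$, is a power distance space if $(X,d)$ is a distance space and $d(x,y)\le\tau(p,\sigma;x,y,z;d)$ for all $x,y,z\in X$. *)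

theory Defs
  imports Complex_Main "HOL-Library.Extended_Real"
begin

locale distance_space =
  fixes X :: "'a set" and d :: "'a \<Rightarrow> 'a \<Rightarrow> real"
  assumes dist_nonneg: "\<lbrakk>x \<in> X; y \<in> X\<rbrakk> \<Longrightarrow> 0 \<le> d x y"
    and dist_eq_0_iff: "\<lbrakk>x \<in> X; y \<in> X\<rbrakk> \<Longrightarrow> d x y = 0 \<longleftrightarrow> x = y"
    and dist_commute: "\<lbrakk>x \<in> X; y \<in> X\<rbrakk> \<Longrightarrow> d x y = d y x"

definition dist_ball :: "'a set \<Rightarrow> ('a \<Rightarrow> 'a \<Rightarrow> real) \<Rightarrow> 'a \<Rightarrow> real \<Rightarrow> 'a set" where
  "dist_ball X d x r = {y \<in> X. d x y < r}"

definition dist_open :: "'a set \<Rightarrow> ('a \<Rightarrow> 'a \<Rightarrow> real) \<Rightarrow> 'a set \<Rightarrow> bool" where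
  "dist_open X d U \<longleftrightarrow> U \<subseteq> X \<and> (\<forall>x\<in>U. \<exists>r>0. dist_ball X d x r \<subseteq> U)"

text \<open>
  The cases \<open>p = \<infinity>, 0, -\<infinity>\<close> are the limits in \<open>p\<close> of the generic formula.
  For \<open>p < 0\<close> a vanishing distance must be split off, because \<open>0 powr p = 0\<close>
  in HOL, whereas the limiting value of the whole expression is \<open>0\<close>.
\<close>
definition power_triangle ::
    "ereal \<Rightarrow> real \<Rightarrow> 'a \<Rightarrow> 'a \<Rightarrow> 'a \<Rightarrow> ('a \<Rightarrow> 'a \<Rightarrow> real) \<Rightarrow> real" where
  "power_triangle p \<sigma> x y z d =
     (case p of
        PInfty \<Rightarrow> 2 * \<sigma> * max (d x z) (d z y)
      | MInfty \<Rightarrow> 2 * \<sigma> * min (d x z) (d z y)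
      | ereal q \<Rightarrow>
          if q = 0 then 2 * \<sigma> * sqrt (d x z) * sqrt (d z y)
          else if q < 0 \<and> (d x z = 0 \<or> d z y = 0) then 0
          else 2 * \<sigma> * (1/2 * d x z powr q + 1/2 * d z y powr q) powr (1 / q))"

locale power_distance_space = distance_space X d
  for X :: "'a set" and d :: "'a \<Rightarrow> 'a \<Rightarrow> real" +
  fixes p :: ereal and \<sigma> :: real
  assumes sigma_pos: "\<sigma> > 0"
    and power_triangle_ineq:
      "\<lbrakk>x \<in> X; y \<in> X; z \<in> X\<rbrakk> \<Longrightarrow> d x y \<le> power_triangle p \<sigma> x y z d"

text \<open>\<open>2\<^sup>1\<^sup>/\<^sup>p\<close>, with value \<open>1\<close> at \<open>p = \<plusminus>\<infinity>\<close>; only meaningful for \<open>p \<noteq> 0\<close>.\<close>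
definition two_root :: "ereal \<Rightarrow> real" where
  "two_root p = (case p of ereal q \<Rightarrow> 2 powr (1 / q) | PInfty \<Rightarrow> 1 | MInfty \<Rightarrow> 1)"

end

theory Submission
  imports Defs
begin

text \<open>
  For finite \<open>p = q\<close>, the hypothesis \<open>2 * \<sigma> \<le> two_root p\<close> absorbs the factor \<open>2 * \<sigma>\<close> when
  \<open>1/2\<close> is pulled out of the power mean, so the power triangle inequality implies
  \<open>d x y \<le> (d x z powr q + d z y powr q) powr (1 / q)\<close>. For a centre \<open>z\<close> with \<open>a = d x z < r\<close>,
  the radius \<open>(r powr q - a powr q) powr (1 / q)\<close> then works if \<open>q > 0\<close>; for \<open>p = \<infinity>\<close> the
  radius \<open>r\<close> works. For \<open>p < 0\<close> the bound is at most \<open>a\<close>, so every radius works.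
\<close>

lemma power_mean_le_power_sum:
  fixes A B q \<sigma> :: real
  assumes "0 \<le> A" "0 \<le> B" "2 * \<sigma> \<le> 2 powr (1 / q)"
  shows "2 * \<sigma> * (1/2 * A + 1/2 * B) powr (1 / q) \<le> (A + B) powr (1 / q)"
proof -
  have "2 * \<sigma> * (1/2 * A + 1/2 * B) powr (1 / q)
      \<le> 2 powr (1 / q) * (1/2 * A + 1/2 * B) powr (1 / q)"
    using assms(3) by (intro mult_right_mono) auto
  also have "\<dots> = (2 * (1/2 * A + 1/2 * B)) powr (1 / q)"
    using assms(1,2) by (subst powr_mult) auto
  also have "2 * (1/2 * A + 1/2 * B) = A + B"
    by simp
  finally show ?thesis .
qed

text \<open>The outer exponent \<open>1 / q\<close> is negative, so dropping the nonnegative term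
  \<open>b powr q\<close> from the positive base can only increase the value.\<close>

lemma power_sum_le_left:
  fixes a b q :: real
  assumes "0 < a" "q < 0"
  shows "(a powr q + b powr q) powr (1 / q) \<le> a"
proof -
  have "(a powr q + b powr q) powr (1 / q) \<le> (a powr q) powr (1 / q)"
    using assms by (intro powr_mono2') auto
  also have "\<dots> = a"
    using assms by (simp add: powr_powr)
  finally show ?thesis .
qed

text \<open>Both sides say \<open>a powr q + b powr q < r powr q\<close>; solving this for
  \<open>b\<close> gives the radius used when \<open>q > 0\<close>.\<close>

lemma power_sum_less_iff:
  fixes a b q r :: real
  assumes "0 < q" "0 \<le> a" "a < r" "0 \<le> b"
  shows "(a powr q + b powr q) powr (1 / q) < r \<longleftrightarrow> b < (r powr q - a powr q) powr (1 / q)"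
proof -
  have root_less: "u powr (1 / q) < v \<longleftrightarrow> u < v powr q" if "0 \<le> u" "0 \<le> v" for u v :: real
    using powr_less_mono2[of q "u powr (1 / q)" v] powr_less_mono2[of "1 / q" u "v powr q"]
      powr_mono2[of q v "u powr (1 / q)"] that assms(1)
    by (auto simp: powr_powr)
  have less_root: "u < v powr (1 / q) \<longleftrightarrow> u powr q < v" if "0 \<le> u" "0 \<le> v" for u v :: real
    using powr_less_mono2[of q u "v powr (1 / q)"] powr_less_mono2[of "1 / q" "u powr q" v]
      that assms(1)
    by (auto simp: powr_powr)
  \<comment> \<open>\<open>less_root\<close> is applied with \<open>v = r powr q - a powr q\<close>,
    which must be nonnegative.\<close>
  have "a powr q < r powr q"
    using assms by (intro powr_less_mono2) auto
  then show ?thesis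
    using assms by (subst root_less, simp, simp, subst less_root) auto
qed

theorem corollary4p14:
  fixes X :: "'a set" and d :: "'a \<Rightarrow> 'a \<Rightarrow> real" and p :: ereal and \<sigma> :: real
    and x :: 'a and r :: real
  assumes "power_distance_space X d p \<sigma>"
    and "p \<noteq> 0"
    and "2 * \<sigma> \<le> two_root p"
    and "x \<in> X" and "r > 0"
  shows "dist_open X d (dist_ball X d x r)"
proof -
  interpret power_distance_space X d p \<sigma> by fact
  have "\<exists>s>0. \<forall>y\<in>X. d z y < s \<longrightarrow> d x y < r" if z: "z \<in> X" "d x z < r" for z
  proof -
    have tri: "d x y \<le> power_triangle p \<sigma> x y z d" if "y \<in> X" for y
      using power_triangle_ineq \<open>x \<in> X\<close> that z(1) by blast
    have xz: "0 \<le> d x z"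
      using dist_nonneg \<open>x \<in> X\<close> z(1) by blast
    have zy: "0 \<le> d z y" if "y \<in> X" for y
      using dist_nonneg z(1) that by blast
    show ?thesis
    proof (cases p)
      case PInf
      have "d x y < r" if "y \<in> X" "d z y < r" for y
      proof -
        \<comment> \<open>\<open>two_root\<close> is \<open>1\<close> at infinity, so
          \<open>2 * \<sigma> \<le> 1\<close>.\<close>
        have "2 * \<sigma> * max (d x z) (d z y) \<le> 1 * max (d x z) (d z y)"
          using assms(3) PInf xz
          by (intro mult_right_mono) (auto simp: two_root_def)
        then show ?thesis
          using tri[OF that(1)] PInf z(2) that(2) by (simp add: power_triangle_def)
      qed
      then show ?thesis using \<open>r > 0\<close> by blast
    next
      case MInf
      have "d x y < r" if "y \<in> X" for y
      proof -
        have "2 * \<sigma> * min (d x z) (d z y) \<le> 1 * min (d x z) (d z y)"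
          using assms(3) MInf xz zy[OF that]
          by (intro mult_right_mono) (auto simp: two_root_def)
        then show ?thesis
          using tri[OF that] MInf z(2) by (simp add: power_triangle_def)
      qed
      then show ?thesis by (intro exI[of _ 1]) auto
    next
      case (real q)
      then have "q \<noteq> 0" using \<open>p \<noteq> 0\<close> by auto
      \<comment> \<open>For \<open>q < 0\<close> the generic formula is available only when both
        distances are nonzero; otherwise \<open>power_triangle\<close> is set to
        \<open>0\<close>.\<close>
      have le_sum: "d x y \<le> (d x z powr q + d z y powr q) powr (1 / q)"
        if "y \<in> X" "0 < q \<or> (d x z \<noteq> 0 \<and> d z y \<noteq> 0)" for y
      proof -
        have "d x y \<le> 2 * \<sigma> * (1/2 * d x z powr q + 1/2 * d z y powr q) powr (1 / q)"
          using tri[OF that(1)] real that(2) \<open>q \<noteq> 0\<close>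
          by (auto simp: power_triangle_def split: if_splits)
        also have "\<dots> \<le> (d x z powr q + d z y powr q) powr (1 / q)"
          using assms(3) real by (intro power_mean_le_power_sum) (auto simp: two_root_def)
        finally show ?thesis .
      qed
      show ?thesis
      proof (cases "0 < q")
        case True
        let ?s = "(r powr q - d x z powr q) powr (1 / q)"
        have "d x z powr q < r powr q"
          using True z xz by (intro powr_less_mono2) auto
        then have "?s > 0" by simp
        moreover have "d x y < r" if "y \<in> X" "d z y < ?s" for y
          using le_sum[of y] power_sum_less_iff[of q "d x z" r "d z y"] True z(2) that
            xz zy[OF that(1)]
          by auto
        ultimately show ?thesis by blast
      next
        case False
        then have "q < 0" using \<open>q \<noteq> 0\<close> by simp
        have "d x y < r" if "y \<in> X" for y
        \<comment> \<open>A vanishing distance makes the bound \<open>0 < r\<close>; otherwise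
          \<open>d x z > 0\<close>, as \<open>power_sum_le_left\<close> requires.\<close>
        proof (cases "d x z = 0 \<or> d z y = 0")
          case True
          then have "d x y \<le> 0"
            using tri[OF that] real \<open>q < 0\<close> by (auto simp: power_triangle_def)
          then show ?thesis using \<open>r > 0\<close> by simp
        next
          case False
          then show ?thesis
            using le_sum[OF that] power_sum_le_left[of "d x z" q "d z y"] \<open>q < 0\<close> z(2) xz
            by auto
        qed
        then show ?thesis by (intro exI[of _ 1]) auto
      qed
    qed
  qed
  then show ?thesis
    unfolding dist_open_def dist_ball_def by blast
qed

end
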